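(* Let $F=\sqrt[m]{A}$ be an $m$-th root Finsler metric on an open subset $U\subseteq\mathbb{R}^n$, with S-curvature $\mathbf{S}$, mean Berwald curvature $\mathbf{E}$ and angular metric $\mathbf{h}$. (i) Let $\eta=\eta_i(x)y^i$ be a $1$-form on $U$. The following are equivalent: (ia) $\mathbf{S}=(n+1)cF+\eta$ for some scalar function $c=c(x)$ on $U$; (ib) $\mathbf{S}=\eta$. (ii) The following are equivalent: (iia) $\mathbf{E}=\frac{n+1}{2}\,c\,F^{-1}\mathbf{h}$ for some scalar function $c=c(x)$ on $U$; (iib) $\mathbf{E}=0$.
   Context: A Finsler metric on a manifold $M$ of dimension $n$ is a function $F:TM\to[0,\infty)$ that is $C^\infty$ on $TM_0=TM\setminus\{0\}$, positively $1$-homogeneous on the fibers of $TM$, and such that $g_{ij}(x,y)=\frac12\frac{\partial^2F^2}{\partial y^i\partial y^j}$ is positive definite for all $y\neq0$. An $m$-th root Finsler metric is a Finsler metric of the form $F=\sqrt[m]{A}$, where $A=a_{i_1\dots i_m}(x)y^{i_1}\cdots y^{i_m}$ with $a_{i_1\dots i_m}$ symmetric in all its indices ($m\ge 2$ an integer). The spray coefficients of $F$ are $G^i=\frac14 g^{il}\big[\frac{\partial^2F^2}{\partial x^k\partial y^l}y^k-\frac{\partial F^2}{\partial x^l}\big]$; geodesics satisfy $\ddot\sigma^i+2G^i(\sigma,\dot\sigma)=0$. The Berwald curvature is $B^i_{\ jkl}=\frac{\partial^3G^i}{\partial y^j\partial y^k\partial y^l}$ and the mean Berwald curvature is $\mathbf{E}=(E_{jk})$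 with $E_{jk}=\frac12B^m_{\ jkm}$ (sum over $m$). The angular metric is $\mathbf{h}=(h_{ij})$ with $h_{ij}=F\,F_{y^iy^j}$. The distortion is $\tau(x,y)=\ln\Big[\frac{\sqrt{\det(g_{ij}(x,y))}}{\mathrm{Vol}(B^n(1))}\cdot\mathrm{Vol}\{(y^i)\in\mathbb{R}^n: F(y^i\frac{\partial}{\partial x^i}|_x)<1\}\Big]$, where $B^n(1)$ is the Euclidean unit ball. The S-curvature is $\mathbf{S}(x,y)=\frac{d}{dt}\big[\tau(\sigma(t),\dot\sigma(t))\big]_{t=0}$, where $\sigma$ is the geodesic with $\sigma(0)=x$, $\dot\sigma(0)=y$. *)

theory Defs
  imports "HOL-Analysis.Analysis"
begin

text \<open>
  The tangent bundle of an open set \<open>U\<close> of \<open>real ^ 'n\<close> is \<open>U \<times> UNIV\<close>; a function on it is a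
  curried function of the base point \<open>x\<close> and the vector \<open>y\<close>, and only its values at \<open>x \<in> U\<close>
  matter. Tensors on the slit tangent bundle are given by their components and are meaningful
  only for \<open>y \<noteq> 0\<close>.
\<close>

fun Ck_on :: "nat \<Rightarrow> ('a::euclidean_space \<Rightarrow> real) \<Rightarrow> 'a set \<Rightarrow> bool" where
  "Ck_on 0 f S \<longleftrightarrow> continuous_on S f"
| "Ck_on (Suc k) f S \<longleftrightarrow>
     (\<forall>x\<in>S. f differentiable (at x)) \<and>
     (\<forall>b\<in>Basis. Ck_on k (\<lambda>x. frechet_derivative f (at x) b) S)"

text \<open>The derivatives are taken at interior points, so the domain is meant to be open.\<close>

definition smooth_on :: "('a::euclidean_space \<Rightarrow> real) \<Rightarrow> 'a set \<Rightarrow> bool" where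
  "smooth_on f S \<longleftrightarrow> (\<forall>k. Ck_on k f S)"

definition partial :: "'n::finite \<Rightarrow> (real ^ 'n \<Rightarrow> real) \<Rightarrow> real ^ 'n \<Rightarrow> real" where
  "partial i f x = deriv (\<lambda>t. f (x + t *\<^sub>R axis i 1)) 0"

type_synonym 'n tfun = "real ^ 'n \<Rightarrow> real ^ 'n \<Rightarrow> real"

definition fund_tensor :: "'n::finite tfun \<Rightarrow> real ^ 'n \<Rightarrow> real ^ 'n \<Rightarrow> real ^ 'n ^ 'n" where
  "fund_tensor F x y = (\<chi> i j. (1/2) * partial i (partial j (\<lambda>z. (F x z)\<^sup>2)) y)"

definition finsler_metric :: "(real ^ 'n::finite) set \<Rightarrow> 'n tfun \<Rightarrow> bool" where
  "finsler_metric U F \<longleftrightarrow>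
     (\<forall>x\<in>U. \<forall>y. F x y \<ge> 0) \<and>
     smooth_on (\<lambda>(x, y). F x y) (U \<times> (- {0})) \<and>
     (\<forall>x\<in>U. \<forall>y. \<forall>r>0. F x (r *\<^sub>R y) = r * F x y) \<and>
     (\<forall>x\<in>U. \<forall>y. y \<noteq> 0 \<longrightarrow> (\<forall>v. v \<noteq> 0 \<longrightarrow> v \<bullet> (fund_tensor F x y *v v) > 0))"

text \<open>
  The coefficients \<open>a\<^bsub>i\<^sub>1\<dots>i\<^sub>m\<^esub>(x)\<close> are indexed by lists of length \<open>m\<close> over the index type;
  symmetry is invariance under rearranging the list.
\<close>

definition sym_form :: "nat \<Rightarrow> ('n list \<Rightarrow> real) \<Rightarrow> real ^ 'n::finite \<Rightarrow> real" where
  "sym_form m a y = (\<Sum>is | length is = m. a is * prod_list (map (\<lambda>i. y $ i) is))"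

definition mth_root_finsler_metric :: "nat \<Rightarrow> (real ^ 'n::finite) set \<Rightarrow> 'n tfun \<Rightarrow> bool" where
  "mth_root_finsler_metric m U F \<longleftrightarrow>
     finsler_metric U F \<and>
     (\<exists>a :: real ^ 'n \<Rightarrow> 'n list \<Rightarrow> real.
        (\<forall>x\<in>U. \<forall>is js. length is = m \<longrightarrow> mset is = mset js \<longrightarrow> a x is = a x js) \<and>
        (\<forall>x\<in>U. \<forall>y. F x y = root m (sym_form m (a x) y)))"

definition spray :: "'n::finite tfun \<Rightarrow> real ^ 'n \<Rightarrow> real ^ 'n \<Rightarrow> real ^ 'n" where
  "spray F x y = (\<chi> i. (1/4) * (\<Sum>l\<in>UNIV. matrix_inv (fund_tensor F x y) $ i $ l *
     ((\<Sum>k\<in>UNIV. partial k (\<lambda>x'. partial l (\<lambda>z. (F x' z)\<^sup>2) y) x * y $ k)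
      - partial l (\<lambda>x'. (F x' y)\<^sup>2) x)))"

definition berwald ::
  "'n::finite tfun \<Rightarrow> real ^ 'n \<Rightarrow> real ^ 'n \<Rightarrow> 'n \<Rightarrow> 'n \<Rightarrow> 'n \<Rightarrow> 'n \<Rightarrow> real" where
  "berwald F x y i j k l = partial j (partial k (partial l (\<lambda>z. spray F x z $ i))) y"

definition mean_berwald :: "'n::finite tfun \<Rightarrow> real ^ 'n \<Rightarrow> real ^ 'n \<Rightarrow> real ^ 'n ^ 'n" where
  "mean_berwald F x y = (\<chi> j k. (1/2) * (\<Sum>r\<in>UNIV. berwald F x y r j k r))"

definition angular_metric :: "'n::finite tfun \<Rightarrow> real ^ 'n \<Rightarrow> real ^ 'n \<Rightarrow> real ^ 'n ^ 'n" where
  "angular_metric F x y = (\<chi> i j. F x y * partial i (partial j (F x)) y)"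

definition distortion :: "'n::finite tfun \<Rightarrow> real ^ 'n \<Rightarrow> real ^ 'n \<Rightarrow> real" where
  "distortion F x y =
     ln (sqrt (det (fund_tensor F x y)) / measure lebesgue (ball (0 :: real ^ 'n) 1) *
         measure lebesgue {z. F x z < 1})"

text \<open>\<open>v\<close> is the velocity field of the geodesic \<open>\<sigma>\<close>, defined on the open interval \<open>I\<close>.\<close>

definition geodesic ::
  "(real ^ 'n::finite) set \<Rightarrow> 'n tfun \<Rightarrow> real set \<Rightarrow>
   (real \<Rightarrow> real ^ 'n) \<Rightarrow> (real \<Rightarrow> real ^ 'n) \<Rightarrow> bool" where
  "geodesic U F I \<sigma> v \<longleftrightarrow>
     (\<forall>t\<in>I. \<sigma> t \<in> U \<and> v t \<noteq> 0 \<and>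
        (\<sigma> has_vector_derivative v t) (at t) \<and>
        (v has_vector_derivative (- 2 *\<^sub>R spray F (\<sigma> t) (v t))) (at t))"

text \<open>
  For a Finsler metric on an open set and \<open>x \<in> U\<close>, \<open>y \<noteq> 0\<close>, the geodesic with initial data
  \<open>(x, y)\<close> exists and is unique near \<open>0\<close>, so the description below determines \<open>s\<close>.
\<close>

definition S_curvature ::
  "(real ^ 'n::finite) set \<Rightarrow> 'n tfun \<Rightarrow> real ^ 'n \<Rightarrow> real ^ 'n \<Rightarrow> real" where
  "S_curvature U F x y =
     (THE s. \<exists>\<epsilon>>0. \<exists>\<sigma> v. geodesic U F {-\<epsilon><..<\<epsilon>} \<sigma> v \<and> \<sigma> 0 = x \<and> v 0 = y \<and>
        ((\<lambda>t. distortion F (\<sigma> t) (v t)) has_real_derivative s) (at 0))"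

end

theory Submission
  imports Defs
begin

text \<open>
  An \<open>m\<close>-th root Finsler metric is reversible. Indeed \<open>A(-y) = (-1)\<^sup>m A(y)\<close>, and for odd \<open>m\<close> the
  condition \<open>F \<ge> 0\<close> at both \<open>y\<close> and \<open>-y\<close> would force \<open>F = 0\<close>. Hence
  \<open>F(x, r y) = \<bar>r\<bar> F(x, y)\<close> for every \<open>r \<noteq> 0\<close>, negative \<open>r\<close> included
  (\<open>mth_root_finsler_metric_abs_homogeneous\<close>). Both equivalences are then parity arguments in \<open>y\<close>.

  The fundamental tensor is even and the spray satisfies \<open>G(x, r y) = r\<^sup>2 G(x, y)\<close>
  (\<open>spray_scale\<close>). Three derivatives turn the even spray into an odd mean Berwald curvature, while
  \<open>F\<^sup>-\<^sup>1 h\<close> is even; so \<open>E\<close> can be a multiple, constant on fibres, of \<open>F\<^sup>-\<^sup>1 h\<close> only if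
  \<open>E = 0\<close>.

  For the S-curvature, \<open>t \<mapsto> \<sigma>(r t)\<close> is again a geodesic and the distortion is
  unchanged along it, so \<open>S(x, r y) = r S(x, y)\<close> (\<open>S_value_scale\<close>). A \<open>1\<close>-form is odd too, whereas
  \<open>c F\<close> is even, so \<open>S = (n + 1) c F + \<eta>\<close> forces \<open>c F = 0\<close>.

  Two analytic facts support this. The spray is smooth on the slit tangent bundle, by Cramer's rule
  for the inverse of the fundamental tensor (\<open>smooth_tfun_spray\<close>); so the iterated partial
  derivatives exist and can be compared at \<open>y\<close> and \<open>-y\<close>. Smoothness also makes the spray locally
  Lipschitz, so geodesics are locally unique and the description that defines \<open>S\<close> has at most one
  value (\<open>S_value_unique\<close>). If it has none at \<open>(x, y)\<close>, it has none at any \<open>(x, r y)\<close>, and \<open>S\<close>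
  takes one and the same value at all of these; comparing \<open>r = 1\<close>, \<open>-1\<close> and \<open>2\<close> in
  \<open>S = (n + 1) c F + \<eta>\<close> again gives \<open>c F = 0\<close>.
\<close>

section \<open>Functions of class \<open>C\<^sup>k\<close>\<close>

lemma Ck_on_has_derivative:
  assumes "Ck_on (Suc k) f S" "x \<in> S"
  shows "(f has_derivative frechet_derivative f (at x)) (at x)"
  using assms by (simp add: frechet_derivative_works)

lemma Ck_on_cong:
  assumes "open S" "\<And>x. x \<in> S \<Longrightarrow> f x = g x" "Ck_on k f S"
  shows "Ck_on k g S"
  using assms(2,3)
proof (induction k arbitrary: f g)
  case 0
  then show ?case
    using continuous_on_cong by fastforce
next
  case (Suc k)
  have g: "(g has_derivative frechet_derivative f (at x)) (at x)" if "x \<in> S" for x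
    using Ck_on_has_derivative[OF Suc.prems(2) that] assms(1) that Suc.prems(1)
    by (rule has_derivative_transform_within_open)
  have "frechet_derivative f (at x) = frechet_derivative g (at x)" if "x \<in> S" for x
    using frechet_derivative_at[OF g[OF that]] .
  then have "Ck_on k (\<lambda>x. frechet_derivative g (at x) b) S" if "b \<in> Basis" for b
    using Suc.IH[of "\<lambda>x. frechet_derivative f (at x) b" "\<lambda>x. frechet_derivative g (at x) b"]
      Suc.prems(2) that by simp
  then show ?case
    using g by (auto simp: differentiable_def)
qed

lemma Ck_on_SucI:
  assumes D: "\<And>x. x \<in> S \<Longrightarrow> (f has_derivative D x) (at x)"
    and Ck: "\<And>b. b \<in> Basis \<Longrightarrow> Ck_on k (\<lambda>x. D x b) S"
    and "open S"
  shows "Ck_on (Suc k) f S"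
proof -
  have "D x = frechet_derivative f (at x)" if "x \<in> S" for x
    using frechet_derivative_at[OF D[OF that]] .
  then have "Ck_on k (\<lambda>x. frechet_derivative f (at x) b) S" if "b \<in> Basis" for b
    using Ck_on_cong[OF \<open>open S\<close> _ Ck[OF that]] by simp
  then show ?thesis
    using D by (auto simp: differentiable_def)
qed

lemma Ck_on_SucD: "Ck_on (Suc k) f S \<Longrightarrow> Ck_on k f S"
proof (induction k arbitrary: f)
  case 0
  then show ?case
    by (auto intro!: differentiable_imp_continuous_on simp: differentiable_at_imp_differentiable_on)
next
  case (Suc k)
  then show ?case by simp
qed

lemma Ck_on_const: "Ck_on k (\<lambda>_. c) S"
proof (induction k arbitrary: c)
  case (Suc k)
  then show ?case by simp
qed simp

lemma Ck_on_add:
  assumes "open S" "Ck_on k f S" "Ck_on k g S"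
  shows "Ck_on k (\<lambda>x. f x + g x) S"
  using assms(2,3)
proof (induction k arbitrary: f g)
  case 0
  then show ?case by (simp add: continuous_on_add)
next
  case (Suc k)
  show ?case
  proof (rule Ck_on_SucI[OF _ _ \<open>open S\<close>])
    show "((\<lambda>x. f x + g x) has_derivative
        (\<lambda>h. frechet_derivative f (at x) h + frechet_derivative g (at x) h)) (at x)"
      if "x \<in> S" for x
      by (intro has_derivative_add Ck_on_has_derivative[OF Suc.prems(1) that]
          Ck_on_has_derivative[OF Suc.prems(2) that])
    show "Ck_on k (\<lambda>x. frechet_derivative f (at x) b + frechet_derivative g (at x) b) S"
      if "b \<in> Basis" for b
      using Suc.prems that by (intro Suc.IH) auto
  qed
qed

lemma Ck_on_mult:
  assumes "open S" "Ck_on k f S" "Ck_on k g S"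
  shows "Ck_on k (\<lambda>x. f x * g x) S"
  using assms(2,3)
proof (induction k arbitrary: f g)
  case 0
  then show ?case by (simp add: continuous_on_mult)
next
  case (Suc k)
  show ?case
  proof (rule Ck_on_SucI[OF _ _ \<open>open S\<close>])
    show "((\<lambda>x. f x * g x) has_derivative
        (\<lambda>h. f x * frechet_derivative g (at x) h + frechet_derivative f (at x) h * g x)) (at x)"
      if "x \<in> S" for x
      by (intro has_derivative_mult Ck_on_has_derivative[OF Suc.prems(1) that]
          Ck_on_has_derivative[OF Suc.prems(2) that])
    show "Ck_on k (\<lambda>x. f x * frechet_derivative g (at x) b + frechet_derivative f (at x) b * g x) S"
      if "b \<in> Basis" for b
      using Suc.prems Suc.prems[THEN Ck_on_SucD] that
      by (intro Ck_on_add[OF \<open>open S\<close>] Suc.IH) auto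
  qed
qed

lemma Ck_on_inverse:
  assumes "open S" "Ck_on k f S" "\<And>x. x \<in> S \<Longrightarrow> f x \<noteq> 0"
  shows "Ck_on k (\<lambda>x. inverse (f x)) S"
  using assms(2)
proof (induction k)
  case 0
  then show ?case using assms(3) by (simp add: continuous_on_inverse)
next
  case (Suc k)
  note inv = Suc.IH[OF Ck_on_SucD[OF Suc.prems]]
  show ?case
  proof (rule Ck_on_SucI[OF _ _ \<open>open S\<close>])
    show "((\<lambda>x. inverse (f x)) has_derivative
        (\<lambda>h. (-1) * (inverse (f x) * frechet_derivative f (at x) h * inverse (f x)))) (at x)"
      if "x \<in> S" for x
      using Deriv.has_derivative_inverse[OF assms(3)[OF that] Ck_on_has_derivative[OF Suc.prems that]]
      by simp
    show "Ck_on k (\<lambda>x. (-1) * (inverse (f x) * frechet_derivative f (at x) b * inverse (f x))) S"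
      if "b \<in> Basis" for b
      using Suc.prems that
      by (intro Ck_on_mult[OF \<open>open S\<close>] Ck_on_const inv) auto
  qed
qed

lemma Ck_on_linear:
  assumes "bounded_linear f" "open S"
  shows "Ck_on k f S"
proof (cases k)
  case 0
  then show ?thesis
    using assms(1) by (simp add: linear_continuous_on)
next
  case (Suc j)
  show ?thesis
    unfolding Suc
    using bounded_linear_imp_has_derivative[OF assms(1)]
    by (rule Ck_on_SucI[OF _ _ assms(2)]) (rule Ck_on_const)
qed

section \<open>Smooth functions\<close>

lemma smooth_on_cong:
  "open S \<Longrightarrow> (\<And>x. x \<in> S \<Longrightarrow> f x = g x) \<Longrightarrow> smooth_on f S \<Longrightarrow> smooth_on g S"
  using Ck_on_cong unfolding smooth_on_def by blast

lemma smooth_on_const: "smooth_on (\<lambda>_. c) S"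
  by (simp add: smooth_on_def Ck_on_const)

lemma smooth_on_add:
  "open S \<Longrightarrow> smooth_on f S \<Longrightarrow> smooth_on g S \<Longrightarrow> smooth_on (\<lambda>x. f x + g x) S"
  by (simp add: smooth_on_def Ck_on_add)

lemma smooth_on_mult:
  "open S \<Longrightarrow> smooth_on f S \<Longrightarrow> smooth_on g S \<Longrightarrow> smooth_on (\<lambda>x. f x * g x) S"
  by (simp add: smooth_on_def Ck_on_mult)

lemma smooth_on_inverse:
  "open S \<Longrightarrow> smooth_on f S \<Longrightarrow> (\<And>x. x \<in> S \<Longrightarrow> f x \<noteq> 0) \<Longrightarrow> smooth_on (\<lambda>x. inverse (f x)) S"
  by (simp add: smooth_on_def Ck_on_inverse)

lemma smooth_on_linear: "bounded_linear f \<Longrightarrow> open S \<Longrightarrow> smooth_on f S"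
  by (simp add: smooth_on_def Ck_on_linear)

lemma smooth_on_diff:
  assumes "open S" "smooth_on f S" "smooth_on g S"
  shows "smooth_on (\<lambda>x. f x - g x) S"
  using smooth_on_add[OF assms(1,2) smooth_on_mult[OF assms(1) smooth_on_const[of "-1"] assms(3)]]
  by simp

lemma smooth_on_sum:
  assumes "open S" "\<And>i. i \<in> I \<Longrightarrow> smooth_on (f i) S"
  shows "smooth_on (\<lambda>x. \<Sum>i\<in>I. f i x) S"
  using assms(2)
  by (induction I rule: infinite_finite_induct)
    (auto intro!: smooth_on_const smooth_on_add[OF assms(1)])

lemma smooth_on_prod:
  assumes "open S" "\<And>i. i \<in> I \<Longrightarrow> smooth_on (f i) S"
  shows "smooth_on (\<lambda>x. \<Prod>i\<in>I. f i x) S"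
  using assms(2)
  by (induction I rule: infinite_finite_induct)
    (auto intro!: smooth_on_const smooth_on_mult[OF assms(1)])

lemma smooth_on_det:
  fixes M :: "'a::euclidean_space \<Rightarrow> real ^ 'n ^ 'n"
  assumes "open S" "\<And>i j. smooth_on (\<lambda>x. M x $ i $ j) S"
  shows "smooth_on (\<lambda>x. det (M x)) S"
  unfolding det_def
  by (intro smooth_on_sum smooth_on_mult smooth_on_prod smooth_on_const assms)

text \<open>
  Cramer's rule for the \<open>l\<close>-th column of the inverse; it shows that the entries of the inverse
  are rational functions of those of the matrix.
\<close>

lemma matrix_inv_entry:
  fixes A :: "real ^ 'n ^ 'n"
  assumes "det A \<noteq> 0"
  shows "matrix_inv A $ i $ l =
    det (\<chi> k j. if j = i then axis l 1 $ k else A $ k $ j) * inverse (det A)"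
proof -
  have "A ** matrix_inv A = mat 1"
    using assms someI_ex[of "\<lambda>B. A ** B = mat 1 \<and> B ** A = mat 1"]
    by (simp add: invertible_det_nz[symmetric] invertible_def matrix_inv_def)
  then have "A *v (matrix_inv A *v axis l 1) = axis l 1"
    by (simp add: matrix_vector_mul_assoc)
  then have "matrix_inv A *v axis l 1 =
      (\<chi> k. det (\<chi> i j. if j = k then axis l 1 $ i else A $ i $ j) / det A)"
    using cramer[OF assms] by blast
  then have "(matrix_inv A *v axis l 1) $ i =
      det (\<chi> k j. if j = i then axis l 1 $ k else A $ k $ j) * inverse (det A)"
    by (simp add: divide_inverse)
  then show ?thesis
    by (simp add: matrix_vector_mul_component inner_axis)
qed

lemma smooth_on_matrix_inv:
  fixes M :: "'a::euclidean_space \<Rightarrow> real ^ 'n ^ 'n"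
  assumes S: "open S" and M: "\<And>i j. smooth_on (\<lambda>x. M x $ i $ j) S"
    and nz: "\<And>x. x \<in> S \<Longrightarrow> det (M x) \<noteq> 0"
  shows "smooth_on (\<lambda>x. matrix_inv (M x) $ i $ l) S"
proof (rule smooth_on_cong[OF S])
  show "det (\<chi> k j. if j = i then axis l 1 $ k else M x $ k $ j) * inverse (det (M x))
      = matrix_inv (M x) $ i $ l" if "x \<in> S" for x
    using matrix_inv_entry[OF nz[OF that]] by simp
  have "smooth_on (\<lambda>x. (\<chi> k j. if j = i then axis l 1 $ k else M x $ k $ j) $ k $ j) S" for k j
    by (cases "j = i") (simp_all add: M smooth_on_const)
  then show "smooth_on (\<lambda>x. det (\<chi> k j. if j = i then axis l 1 $ k else M x $ k $ j)
      * inverse (det (M x))) S"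
    by (intro smooth_on_mult smooth_on_inverse smooth_on_det S M nz)
qed

lemma smooth_on_has_derivative:
  "smooth_on f S \<Longrightarrow> x \<in> S \<Longrightarrow> (f has_derivative frechet_derivative f (at x)) (at x)"
  by (rule Ck_on_has_derivative[of 0]) (auto simp: smooth_on_def simp del: Ck_on.simps)

lemma smooth_on_frechet_derivative:
  assumes "smooth_on f S" "b \<in> Basis"
  shows "smooth_on (\<lambda>x. frechet_derivative f (at x) b) S"
proof -
  have "Ck_on (Suc k) f S" for k
    using assms(1) unfolding smooth_on_def by blast
  then show ?thesis
    using assms(2) by (simp add: smooth_on_def)
qed

lemma smooth_on_imp_continuous_on: "smooth_on f S \<Longrightarrow> continuous_on S f"
  unfolding smooth_on_def by (drule spec[of _ 0]) simp

text \<open>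
  The components of the gradient are continuous, hence bounded on a compact ball, and the ball is
  convex, so the mean value inequality applies.
\<close>

lemma smooth_on_imp_lipschitz_on_cball:
  fixes f :: "'a::euclidean_space \<Rightarrow> real"
  assumes f: "smooth_on f S" and sub: "cball p d \<subseteq> S"
  shows "\<exists>K\<ge>0. \<forall>a\<in>cball p d. \<forall>b\<in>cball p d. \<bar>f a - f b\<bar> \<le> K * norm (a - b)"
proof -
  have "\<exists>M\<ge>0. \<forall>a\<in>cball p d. \<bar>frechet_derivative f (at a) b\<bar> \<le> M" if "b \<in> Basis" for b
  proof -
    have "continuous_on (cball p d) (\<lambda>a. frechet_derivative f (at a) b)"
      using smooth_on_imp_continuous_on[OF smooth_on_frechet_derivative[OF f that]] sub
      by (rule continuous_on_subset)
    then have "bounded ((\<lambda>a. frechet_derivative f (at a) b) ` cball p d)"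
      by (intro compact_imp_bounded compact_continuous_image) auto
    then show ?thesis
      unfolding bounded_pos by (metis imageI less_imp_le real_norm_def)
  qed
  then obtain M where M0: "\<And>b. b \<in> Basis \<Longrightarrow> M b \<ge> 0"
    and M: "\<And>b a. b \<in> Basis \<Longrightarrow> a \<in> cball p d \<Longrightarrow> \<bar>frechet_derivative f (at a) b\<bar> \<le> M b"
    by metis
  have der: "(f has_derivative frechet_derivative f (at a)) (at a)" if "a \<in> cball p d" for a
    using smooth_on_has_derivative[OF f] that sub by blast
  have onorm: "onorm (frechet_derivative f (at a)) \<le> (\<Sum>b\<in>Basis. M b)" if a: "a \<in> cball p d" for a
  proof (rule onorm_le)
    fix h :: 'a
    interpret D: bounded_linear "frechet_derivative f (at a)"
      using der[OF a] by (rule has_derivative_bounded_linear)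
    have "frechet_derivative f (at a) h
        = (\<Sum>b\<in>Basis. (h \<bullet> b) * frechet_derivative f (at a) b)"
      by (subst euclidean_representation[of h, symmetric])
        (simp only: D.sum D.scaleR real_scaleR_def)
    also have "\<bar>\<dots>\<bar> \<le> (\<Sum>b\<in>Basis. norm h * M b)"
      by (intro sum_abs[THEN order_trans] sum_mono)
        (auto simp: abs_mult intro!: mult_mono M a Basis_le_norm)
    finally show "norm (frechet_derivative f (at a) h) \<le> (\<Sum>b\<in>Basis. M b) * norm h"
      by (simp add: sum_distrib_left mult.commute)
  qed
  have "\<bar>f a - f b\<bar> \<le> (\<Sum>b\<in>Basis. M b) * norm (a - b)"
    if "a \<in> cball p d" "b \<in> cball p d" for a b
    using differentiable_bound[OF convex_cball has_derivative_at_withinI[OF der] onorm that(1,2)]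
    by simp
  moreover have "(\<Sum>b\<in>Basis. M b) \<ge> 0"
    using M0 by (rule sum_nonneg)
  ultimately show ?thesis by blast
qed

section \<open>Partial derivatives of functions on the slit tangent bundle\<close>

text \<open>
  Smoothness is required in \<open>x\<close> and \<open>y\<close> jointly, because the spray mixes derivatives in both
  directions.
\<close>

definition smooth_tfun :: "(real ^ 'n::finite) set \<Rightarrow> 'n tfun \<Rightarrow> bool" where
  "smooth_tfun U H \<longleftrightarrow> smooth_on (\<lambda>(x, y). H x y) (U \<times> (- {0}))"

lemma open_slit_tangent: "open U \<Longrightarrow> open (U \<times> (- {0 :: real ^ 'n}))"
  by (intro open_Times) auto

text \<open>
  A partial derivative along the fibre is a directional derivative of the uncurried function in a
  basis direction of the product space. This ties the one-variable \<open>partial\<close> to the Frechet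
  derivatives in the definition of smoothness.
\<close>

lemma smooth_tfun_DERIV_fibre:
  assumes "smooth_tfun U H" "x \<in> U" "y \<noteq> 0"
  shows "((\<lambda>t. H x (y + t *\<^sub>R axis i 1)) has_real_derivative
    frechet_derivative (\<lambda>(x, y). H x y) (at (x, y)) (0, axis i 1)) (at 0)"
proof -
  let ?D = "frechet_derivative (\<lambda>(x, y). H x y) (at (x, y))"
  have H: "((\<lambda>(x, y). H x y) has_derivative ?D) (at (x, y + 0 *\<^sub>R axis i 1))"
    using smooth_on_has_derivative[of _ _ "(x, y)"] assms unfolding smooth_tfun_def by fastforce
  have "((\<lambda>t::real. (x, y + t *\<^sub>R axis i 1)) has_derivative (\<lambda>t. (0, t *\<^sub>R axis i 1))) (at 0)"
    by (auto intro!: derivative_eq_intros)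
  from has_derivative_compose[OF this H]
  have "((\<lambda>t. H x (y + t *\<^sub>R axis i 1)) has_derivative (\<lambda>t. ?D (0, t *\<^sub>R axis i 1))) (at 0)"
    by simp
  moreover have "?D (0, t *\<^sub>R axis i 1) = ?D (0, axis i 1) * t" for t
    using linear_scale[OF has_derivative_linear[OF H], of t "(0, axis i 1)"] by simp
  ultimately show ?thesis
    by (simp add: has_field_derivative_def)
qed

lemma smooth_tfun_DERIV_base:
  assumes "smooth_tfun U H" "x \<in> U" "y \<noteq> 0"
  shows "((\<lambda>t. H (x + t *\<^sub>R axis i 1) y) has_real_derivative
    frechet_derivative (\<lambda>(x, y). H x y) (at (x, y)) (axis i 1, 0)) (at 0)"
proof -
  let ?D = "frechet_derivative (\<lambda>(x, y). H x y) (at (x, y))"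
  have H: "((\<lambda>(x, y). H x y) has_derivative ?D) (at (x + 0 *\<^sub>R axis i 1, y))"
    using smooth_on_has_derivative[of _ _ "(x, y)"] assms unfolding smooth_tfun_def by fastforce
  have "((\<lambda>t::real. (x + t *\<^sub>R axis i 1, y)) has_derivative (\<lambda>t. (t *\<^sub>R axis i 1, 0))) (at 0)"
    by (auto intro!: derivative_eq_intros)
  from has_derivative_compose[OF this H]
  have "((\<lambda>t. H (x + t *\<^sub>R axis i 1) y) has_derivative (\<lambda>t. ?D (t *\<^sub>R axis i 1, 0))) (at 0)"
    by simp
  moreover have "?D (t *\<^sub>R axis i 1, 0) = ?D (axis i 1, 0) * t" for t
    using linear_scale[OF has_derivative_linear[OF H], of t "(axis i 1, 0)"] by simp
  ultimately show ?thesis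
    by (simp add: has_field_derivative_def)
qed

lemma smooth_tfun_partial_fibre:
  assumes "open U" "smooth_tfun U H"
  shows "smooth_tfun U (\<lambda>x. partial i (H x))"
  unfolding smooth_tfun_def
proof (rule smooth_on_cong[OF open_slit_tangent[OF assms(1)]])
  show "smooth_on (\<lambda>p. frechet_derivative (\<lambda>(x, y). H x y) (at p) (0, axis i 1)) (U \<times> (- {0}))"
    using assms(2) unfolding smooth_tfun_def
    by (rule smooth_on_frechet_derivative) (auto simp: Basis_prod_def)
  show "frechet_derivative (\<lambda>(x, y). H x y) (at p) (0, axis i 1) = (case p of (x, y) \<Rightarrow> partial i (H x) y)"
    if "p \<in> U \<times> (- {0})" for p
    using that
    by (cases p) (simp add: partial_def DERIV_imp_deriv[OF smooth_tfun_DERIV_fibre[OF assms(2)]])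
qed

lemma smooth_tfun_partial_base:
  assumes "open U" "smooth_tfun U H"
  shows "smooth_tfun U (\<lambda>x y. partial i (\<lambda>x'. H x' y) x)"
  unfolding smooth_tfun_def
proof (rule smooth_on_cong[OF open_slit_tangent[OF assms(1)]])
  show "smooth_on (\<lambda>p. frechet_derivative (\<lambda>(x, y). H x y) (at p) (axis i 1, 0)) (U \<times> (- {0}))"
    using assms(2) unfolding smooth_tfun_def
    by (rule smooth_on_frechet_derivative) (auto simp: Basis_prod_def)
  show "frechet_derivative (\<lambda>(x, y). H x y) (at p) (axis i 1, 0)
      = (case p of (x, y) \<Rightarrow> partial i (\<lambda>x'. H x' y) x)"
    if "p \<in> U \<times> (- {0})" for p
    using that
    by (cases p) (simp add: partial_def DERIV_imp_deriv[OF smooth_tfun_DERIV_base[OF assms(2)]])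
qed

text \<open>
  Differentiating \<open>H(x, r y) = a H(x, y)\<close> in \<open>y\<close> divides the factor by \<open>r\<close>. The number \<open>r\<close> may be
  negative: with \<open>r = -1\<close> this is the change of parity under differentiation.
\<close>

lemma partial_fibre_scale:
  assumes H: "smooth_tfun U H" and x: "x \<in> U" and r: "r \<noteq> 0"
    and hom: "\<And>y. y \<noteq> 0 \<Longrightarrow> H x (r *\<^sub>R y) = a * H x y"
    and y: "y \<noteq> 0"
  shows "partial i (H x) (r *\<^sub>R y) = a / r * partial i (H x) y"
proof -
  let ?d = "frechet_derivative (\<lambda>(x, y). H x y) (at (x, y)) (0, axis i 1)"
  have d: "((\<lambda>t. H x (y + t *\<^sub>R axis i 1)) has_real_derivative ?d) (at 0)"
    by (rule smooth_tfun_DERIV_fibre[OF H x y])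
  \<comment> \<open>\<open>r y + t e\<^sub>i = r (y + (t / r) e\<^sub>i)\<close>\<close>
  have "((\<lambda>t. a * H x (y + (t / r) *\<^sub>R axis i 1)) has_real_derivative a * (?d * (1 / r))) (at 0)"
    using d r by (intro DERIV_cmult DERIV_chain'[where f="\<lambda>t. t / r" and g="\<lambda>t. H x (y + t *\<^sub>R axis i 1)"])
      (auto intro!: derivative_eq_intros)
  moreover have "\<forall>\<^sub>F t in nhds 0.
      H x (r *\<^sub>R y + t *\<^sub>R axis i 1) = a * H x (y + (t / r) *\<^sub>R axis i 1)"
  proof -
    have "((\<lambda>t. y + (t / r) *\<^sub>R axis i 1) \<longlongrightarrow> y + (0 / r) *\<^sub>R axis i 1) (nhds (0::real))"
      by (intro tendsto_intros filterlim_ident r)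
    then have "\<forall>\<^sub>F t in nhds 0. y + (t / r) *\<^sub>R axis i 1 \<noteq> 0"
      using y by (intro tendsto_imp_eventually_ne) auto
    then show ?thesis
    proof eventually_elim
      case (elim t)
      then show ?case
        using hom[OF elim] r by (simp add: scaleR_right_distrib)
    qed
  qed
  ultimately have "((\<lambda>t. H x (r *\<^sub>R y + t *\<^sub>R axis i 1)) has_real_derivative a * (?d * (1 / r))) (at 0)"
    by (simp add: DERIV_cong_ev)
  then show ?thesis
    using DERIV_imp_deriv[OF d] by (auto simp: partial_def dest!: DERIV_imp_deriv)
qed

lemma partial_base_scale:
  assumes H: "smooth_tfun U H" and "open U" and x: "x \<in> U"
    and hom: "\<And>x. x \<in> U \<Longrightarrow> H x (r *\<^sub>R y) = a * H x y"
    and y: "y \<noteq> 0"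
  shows "partial i (\<lambda>x. H x (r *\<^sub>R y)) x = a * partial i (\<lambda>x. H x y) x"
proof -
  let ?d = "frechet_derivative (\<lambda>(x, y). H x y) (at (x, y)) (axis i 1, 0)"
  have d: "((\<lambda>t. H (x + t *\<^sub>R axis i 1) y) has_real_derivative ?d) (at 0)"
    by (rule smooth_tfun_DERIV_base[OF H x y])
  have "\<forall>\<^sub>F t in nhds (0::real). x + t *\<^sub>R axis i 1 \<in> U"
  proof (rule topological_tendstoD[OF _ \<open>open U\<close>])
    show "((\<lambda>t::real. x + t *\<^sub>R axis i 1) \<longlongrightarrow> x + 0 *\<^sub>R axis i 1) (nhds 0)"
      by (intro tendsto_intros filterlim_ident)
  qed (use x in simp)
  then have "\<forall>\<^sub>F t in nhds 0. H (x + t *\<^sub>R axis i 1) (r *\<^sub>R y) = a * H (x + t *\<^sub>R axis i 1) y"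
    by eventually_elim (rule hom)
  then have "((\<lambda>t. H (x + t *\<^sub>R axis i 1) (r *\<^sub>R y)) has_real_derivative a * ?d) (at 0)"
    using DERIV_cmult[OF d, of a] by (simp add: DERIV_cong_ev)
  then show ?thesis
    using DERIV_imp_deriv[OF d] by (auto simp: partial_def dest!: DERIV_imp_deriv)
qed

section \<open>The spray of a Finsler metric\<close>

lemma finsler_metric_smooth: "finsler_metric U F \<Longrightarrow> smooth_tfun U F"
  by (simp add: finsler_metric_def smooth_tfun_def)

lemma finsler_metric_smooth_square:
  assumes "open U" "finsler_metric U F"
  shows "smooth_tfun U (\<lambda>x y. (F x y)\<^sup>2)"
  using smooth_on_mult[OF open_slit_tangent[OF assms(1)], of "\<lambda>(x, y). F x y" "\<lambda>(x, y). F x y"]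
    finsler_metric_smooth[OF assms(2)]
  by (simp add: smooth_tfun_def case_prod_beta' power2_eq_square)

lemma smooth_tfun_fund_tensor:
  assumes "open U" "finsler_metric U F"
  shows "smooth_tfun U (\<lambda>x y. fund_tensor F x y $ i $ j)"
proof -
  have "smooth_tfun U (\<lambda>x. partial i (partial j (\<lambda>z. (F x z)\<^sup>2)))"
    by (intro smooth_tfun_partial_fibre finsler_metric_smooth_square assms)
  from smooth_on_mult[OF open_slit_tangent[OF assms(1)] smooth_on_const[of "1/2"]
      this[unfolded smooth_tfun_def]]
  show ?thesis
    by (simp add: smooth_tfun_def fund_tensor_def case_prod_beta')
qed

lemma det_fund_tensor_nonzero:
  assumes "finsler_metric U F" "x \<in> U" "y \<noteq> 0"
  shows "det (fund_tensor F x y) \<noteq> 0"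
proof -
  have "v = 0" if "fund_tensor F x y *v v = 0" for v
    using assms that unfolding finsler_metric_def by (metis inner_zero_right less_irrefl)
  then show ?thesis
    by (metis invertible_det_nz invertible_left_inverse matrix_left_invertible_ker)
qed

lemma smooth_tfun_spray:
  assumes "open U" "finsler_metric U F"
  shows "smooth_tfun U (\<lambda>x y. spray F x y $ i)"
proof -
  note V = open_slit_tangent[OF assms(1)]
  note F2 = finsler_metric_smooth_square[OF assms]
  have g: "smooth_on (\<lambda>p. matrix_inv (fund_tensor F (fst p) (snd p)) $ i $ l) (U \<times> (- {0}))" for l
    using smooth_tfun_fund_tensor[OF assms] det_fund_tensor_nonzero[OF assms(2)]
    by (intro smooth_on_matrix_inv[OF V]) (auto simp: smooth_tfun_def case_prod_beta')
  have dxdy: "smooth_on (\<lambda>p. partial k (\<lambda>x'. partial l (\<lambda>z. (F x' z)\<^sup>2) (snd p)) (fst p))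
      (U \<times> (- {0}))" for k l
    using smooth_tfun_partial_base[OF assms(1) smooth_tfun_partial_fibre[OF assms(1) F2]]
    by (simp add: smooth_tfun_def case_prod_beta')
  have dx: "smooth_on (\<lambda>p. partial l (\<lambda>x'. (F x' (snd p))\<^sup>2) (fst p)) (U \<times> (- {0}))" for l
    using smooth_tfun_partial_base[OF assms(1) F2]
    by (simp add: smooth_tfun_def case_prod_beta')
  have y: "smooth_on (\<lambda>p. snd p $ k) (U \<times> (- {0 :: real ^ 'a}))" for k
    by (rule smooth_on_linear[OF _ V])
      (intro bounded_linear_compose[OF bounded_linear_vec_nth] bounded_linear_snd)
  show ?thesis
    unfolding smooth_tfun_def spray_def case_prod_beta' vec_lambda_beta
    by (intro smooth_on_mult[OF V] smooth_on_sum[OF V] smooth_on_diff[OF V] smooth_on_const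
        g dxdy dx y)
qed

text \<open>
  The difference of two solutions attains its maximum \<open>M\<close> on a short interval around \<open>0\<close>. Its
  derivative is at most \<open>L M\<close> there and it vanishes at \<open>0\<close>, so the mean value inequality gives
  \<open>M \<le> L \<delta> M\<close> on an interval of half-length \<open>\<delta>\<close>, which forces \<open>M = 0\<close> once \<open>2 L \<delta> < 1\<close>.
\<close>

lemma ode_local_uniqueness:
  fixes w w' :: "real \<Rightarrow> 'a::real_normed_vector"
  assumes "d > 0" "L \<ge> 0" "e > 0"
    and lip: "\<And>a b. a \<in> cball p d \<Longrightarrow> b \<in> cball p d \<Longrightarrow> norm (f a - f b) \<le> L * norm (a - b)"
    and w: "\<And>t. \<bar>t\<bar> < e \<Longrightarrow> (w has_vector_derivative f (w t)) (at t)"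
    and w': "\<And>t. \<bar>t\<bar> < e \<Longrightarrow> (w' has_vector_derivative f (w' t)) (at t)"
    and init: "w 0 = p" "w' 0 = p"
  shows "\<exists>\<delta>>0. \<forall>t. \<bar>t\<bar> < \<delta> \<longrightarrow> w t = w' t"
proof -
  have "isCont w 0" "isCont w' 0"
    using w[of 0] w'[of 0] \<open>e > 0\<close> by (auto intro: has_vector_derivative_continuous)
  then obtain d1 d2 where d12: "d1 > 0" "d2 > 0"
    "\<And>t. \<bar>t\<bar> < d1 \<Longrightarrow> dist (w t) p < d" "\<And>t. \<bar>t\<bar> < d2 \<Longrightarrow> dist (w' t) p < d"
    using \<open>d > 0\<close> init unfolding continuous_at_eps_delta dist_real_def by (metis diff_zero)
  define \<delta> where "\<delta> = Min {e / 2, d1 / 2, d2 / 2, 1 / (2 * L + 1)}"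
  have \<delta>: "\<delta> > 0" "\<delta> < e" "\<delta> < d1" "\<delta> < d2" "\<delta> \<le> 1 / (2 * L + 1)"
    using d12 \<open>e > 0\<close> \<open>L \<ge> 0\<close> by (auto simp: \<delta>_def min_less_iff_disj)
  have L\<delta>: "2 * (L * \<delta>) < 1"
  proof -
    have "\<delta> * (2 * L + 1) \<le> 1"
      using \<delta>(5) \<open>L \<ge> 0\<close> by (simp add: pos_le_divide_eq)
    then show ?thesis
      using \<delta>(1) by (simp add: algebra_simps)
  qed
  let ?T = "{-\<delta>..\<delta>}"
  have in_ball: "w t \<in> cball p d" "w' t \<in> cball p d" if "t \<in> ?T" for t
  proof -
    have "\<bar>t\<bar> < d1" "\<bar>t\<bar> < d2"
      using that \<delta> by auto
    then show "w t \<in> cball p d" "w' t \<in> cball p d"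
      using d12(3)[of t] d12(4)[of t] by (simp_all add: dist_commute)
  qed
  have der: "((\<lambda>t. w t - w' t) has_vector_derivative f (w t) - f (w' t)) (at t)"
    if "t \<in> ?T" for t
    using that \<delta> by (intro has_vector_derivative_diff w w') auto
  have "continuous_on ?T (\<lambda>t. norm (w t - w' t))"
    using has_vector_derivative_continuous[OF der]
    by (intro continuous_on_norm continuous_at_imp_continuous_on) blast
  then obtain t0 where t0: "t0 \<in> ?T"
    and max: "\<And>t. t \<in> ?T \<Longrightarrow> norm (w t - w' t) \<le> norm (w t0 - w' t0)"
    using continuous_attains_sup[of ?T "\<lambda>t. norm (w t - w' t)"] \<delta>(1) by auto
  let ?M = "norm (w t0 - w' t0)"
  have "norm ((w t0 - w' t0) - (w 0 - w' 0)) \<le> (L * ?M) * norm (t0 - 0)"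
  proof (rule differentiable_bound[of ?T])
    show "((\<lambda>t. w t - w' t) has_derivative (\<lambda>h. h *\<^sub>R (f (w t) - f (w' t)))) (at t within ?T)"
      if "t \<in> ?T" for t
      using der[OF that] by (simp add: has_vector_derivative_def has_derivative_at_withinI)
    show "onorm (\<lambda>h. h *\<^sub>R (f (w t) - f (w' t))) \<le> L * ?M" if "t \<in> ?T" for t
    proof (rule onorm_le)
      fix h :: real
      have "norm (f (w t) - f (w' t)) \<le> L * ?M"
        using lip[OF in_ball[OF that]] mult_left_mono[OF max[OF that] \<open>L \<ge> 0\<close>] by linarith
      then show "norm (h *\<^sub>R (f (w t) - f (w' t))) \<le> L * ?M * norm h"
        using mult_left_mono[of _ _ "\<bar>h\<bar>"] by (simp add: mult.commute[of _ "\<bar>h\<bar>"])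
    qed
  qed (use t0 \<delta>(1) in auto)
  then have "?M \<le> L * ?M * \<bar>t0\<bar>"
    by (simp add: init)
  also have "\<dots> \<le> L * ?M * \<delta>"
    using t0 \<open>L \<ge> 0\<close> by (intro mult_left_mono) auto
  finally have "2 * ?M \<le> 2 * (L * \<delta>) * ?M"
    by (simp add: algebra_simps)
  have "?M = 0"
  proof (rule ccontr)
    assume "?M \<noteq> 0"
    then have "2 * (L * \<delta>) * ?M < 1 * ?M"
      using L\<delta> by (intro mult_strict_right_mono) auto
    with \<open>2 * ?M \<le> 2 * (L * \<delta>) * ?M\<close> show False
      using norm_ge_zero[of "w t0 - w' t0"] by linarith
  qed
  then have "w t = w' t" if "\<bar>t\<bar> < \<delta>" for t
  proof -
    have "t \<in> ?T"
      using that by auto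
    then show ?thesis
      using max[of t] \<open>?M = 0\<close> by simp
  qed
  then show ?thesis
    using \<delta>(1) by blast
qed

text \<open>
  The pair of position and velocity solves the autonomous first order system with right-hand side
  \<open>(y, -2 G(x, y))\<close>, which is Lipschitz on a small ball because the spray is smooth.
\<close>

lemma geodesic_local_uniqueness:
  assumes "open U" "finsler_metric U F" "\<epsilon> > 0" "\<epsilon>' > 0"
    and geo: "geodesic U F {-\<epsilon><..<\<epsilon>} \<sigma> v"
    and geo': "geodesic U F {-\<epsilon>'<..<\<epsilon>'} \<sigma>' v'"
    and init: "\<sigma>' 0 = \<sigma> 0" "v' 0 = v 0"
  shows "\<exists>\<delta>>0. \<forall>t. \<bar>t\<bar> < \<delta> \<longrightarrow> \<sigma> t = \<sigma>' t \<and> v t = v' t"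
proof -
  let ?p = "(\<sigma> 0, v 0)"
  define f where "f p = (snd p, - 2 *\<^sub>R spray F (fst p) (snd p))" for p
  have "?p \<in> U \<times> (- {0})"
    using geo \<open>\<epsilon> > 0\<close> by (auto simp: geodesic_def)
  then obtain d where d: "d > 0" "cball ?p d \<subseteq> U \<times> (- {0})"
    using open_slit_tangent[OF assms(1)] unfolding open_contains_cball by blast
  have "\<exists>K\<ge>0. \<forall>a\<in>cball ?p d. \<forall>b\<in>cball ?p d.
      \<bar>spray F (fst a) (snd a) $ i - spray F (fst b) (snd b) $ i\<bar> \<le> K * norm (a - b)" for i
    using smooth_on_imp_lipschitz_on_cball[OF _ d(2)] smooth_tfun_spray[OF assms(1,2), of i]
    by (simp add: smooth_tfun_def case_prod_beta')
  then obtain K where K0: "\<And>i. K i \<ge> 0" and K: "\<And>i a b. a \<in> cball ?p d \<Longrightarrow> b \<in> cball ?p d \<Longrightarrow>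
      \<bar>spray F (fst a) (snd a) $ i - spray F (fst b) (snd b) $ i\<bar> \<le> K i * norm (a - b)"
    by metis
  have lip: "norm (f a - f b) \<le> (1 + 2 * sum K UNIV) * norm (a - b)"
    if "a \<in> cball ?p d" "b \<in> cball ?p d" for a b
  proof -
    let ?s = "\<lambda>p. spray F (fst p) (snd p)"
    have "norm (?s a - ?s b) \<le> (\<Sum>i\<in>UNIV. \<bar>(?s a - ?s b) $ i\<bar>)"
      by (rule norm_le_l1_cart)
    also have "\<dots> \<le> (\<Sum>i\<in>UNIV. K i * norm (a - b))"
      using K[OF that] by (intro sum_mono) simp
    finally have s: "norm (?s a - ?s b) \<le> sum K UNIV * norm (a - b)"
      by (simp add: sum_distrib_right)
    have "f a - f b = (snd (a - b), - 2 *\<^sub>R (?s a - ?s b))"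
      by (simp add: f_def algebra_simps)
    then have "norm (f a - f b) \<le> norm (snd (a - b)) + norm (- 2 *\<^sub>R (?s a - ?s b))"
      by (simp only: norm_Pair_le)
    also have "\<dots> \<le> norm (a - b) + 2 * (sum K UNIV * norm (a - b))"
      using s norm_snd_le[of "snd (a - b)" "fst (a - b)"] by (simp del: fst_diff snd_diff)
    finally show ?thesis
      by (simp add: algebra_simps)
  qed
  have "\<exists>\<delta>>0. \<forall>t. \<bar>t\<bar> < \<delta> \<longrightarrow> (\<sigma> t, v t) = (\<sigma>' t, v' t)"
  proof (rule ode_local_uniqueness[OF d(1) _ _ lip])
    show "((\<lambda>t. (\<sigma> t, v t)) has_vector_derivative f (\<sigma> t, v t)) (at t)"
      if "\<bar>t\<bar> < min \<epsilon> \<epsilon>'" for t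
    proof -
      have "t \<in> {-\<epsilon><..<\<epsilon>}"
        using that by auto
      then show ?thesis
        using geo by (auto simp: geodesic_def f_def intro!: has_vector_derivative_Pair)
    qed
    show "((\<lambda>t. (\<sigma>' t, v' t)) has_vector_derivative f (\<sigma>' t, v' t)) (at t)"
      if "\<bar>t\<bar> < min \<epsilon> \<epsilon>'" for t
    proof -
      have "t \<in> {-\<epsilon>'<..<\<epsilon>'}"
        using that by auto
      then show ?thesis
        using geo' by (auto simp: geodesic_def f_def intro!: has_vector_derivative_Pair)
    qed
  qed (use assms(3,4) init K0 in \<open>auto simp: sum_nonneg\<close>)
  then show ?thesis
    by simp
qed

section \<open>Absolutely homogeneous Finsler metrics\<close>

text \<open>
  Positive homogeneity together with reversibility, \<open>F(x, -y) = F(x, y)\<close>; a negative \<open>r\<close> is the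
  source of every parity statement below.
\<close>

definition abs_homogeneous :: "(real ^ 'n::finite) set \<Rightarrow> 'n tfun \<Rightarrow> bool" where
  "abs_homogeneous U F \<longleftrightarrow> (\<forall>x\<in>U. \<forall>y. \<forall>r. r \<noteq> 0 \<longrightarrow> F x (r *\<^sub>R y) = \<bar>r\<bar> * F x y)"

text \<open>
  Two differentiations divide the factor \<open>r\<^sup>2\<close> of \<open>F\<^sup>2\<close> by \<open>r\<^sup>2\<close>.
\<close>

lemma fund_tensor_scale:
  assumes "open U" "finsler_metric U F" "abs_homogeneous U F" "x \<in> U" "y \<noteq> 0" "r \<noteq> 0"
  shows "fund_tensor F x (r *\<^sub>R y) = fund_tensor F x y"
proof -
  note F2 = finsler_metric_smooth_square[OF assms(1,2)]
  have "partial j (\<lambda>z. (F x z)\<^sup>2) (r *\<^sub>R y) = r\<^sup>2 / r * partial j (\<lambda>z. (F x z)\<^sup>2) y"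
    if "y \<noteq> 0" for j y
    using assms that by (intro partial_fibre_scale[OF F2])
      (auto simp: abs_homogeneous_def power_mult_distrib)
  then have "partial i (partial j (\<lambda>z. (F x z)\<^sup>2)) (r *\<^sub>R y)
      = r\<^sup>2 / r / r * partial i (partial j (\<lambda>z. (F x z)\<^sup>2)) y" for i j
    using assms by (intro partial_fibre_scale[OF smooth_tfun_partial_fibre[OF assms(1) F2]]) auto
  then show ?thesis
    using \<open>r \<noteq> 0\<close> by (simp add: fund_tensor_def power2_eq_square)
qed

text \<open>
  The inverse fundamental tensor is invariant. In the first term of the bracket the derivative in
  \<open>y\<close> turns the factor \<open>r\<^sup>2\<close> of \<open>F\<^sup>2\<close> into \<open>r\<close> and \<open>y\<^sup>k\<close> restores it; the second term
  keeps \<open>r\<^sup>2\<close>.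
\<close>

lemma spray_scale:
  assumes "open U" "finsler_metric U F" "abs_homogeneous U F" "x \<in> U" "y \<noteq> 0" "r \<noteq> 0"
  shows "spray F x (r *\<^sub>R y) = r\<^sup>2 *\<^sub>R spray F x y"
proof -
  note F2 = finsler_metric_smooth_square[OF assms(1,2)]
  have hom: "(F x (r *\<^sub>R y))\<^sup>2 = r\<^sup>2 * (F x y)\<^sup>2" if "x \<in> U" for x y
    using assms that by (auto simp: abs_homogeneous_def power_mult_distrib)
  have dy: "partial l (\<lambda>z. (F x z)\<^sup>2) (r *\<^sub>R y) = r * partial l (\<lambda>z. (F x z)\<^sup>2) y"
    if "x \<in> U" for l x
    using partial_fibre_scale[where H="\<lambda>x y. (F x y)\<^sup>2" and a="r\<^sup>2",
        OF F2 that \<open>r \<noteq> 0\<close> hom[OF that] \<open>y \<noteq> 0\<close>] \<open>r \<noteq> 0\<close>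
    by (simp add: power2_eq_square)
  have dxdy: "partial k (\<lambda>x'. partial l (\<lambda>z. (F x' z)\<^sup>2) (r *\<^sub>R y)) x
      = r * partial k (\<lambda>x'. partial l (\<lambda>z. (F x' z)\<^sup>2) y) x" for k l
    using partial_base_scale[where H="\<lambda>x. partial l (\<lambda>z. (F x z)\<^sup>2)" and a=r,
        OF smooth_tfun_partial_fibre[OF assms(1) F2] assms(1,4) dy \<open>y \<noteq> 0\<close>] .
  have dx: "partial l (\<lambda>x'. (F x' (r *\<^sub>R y))\<^sup>2) x = r\<^sup>2 * partial l (\<lambda>x'. (F x' y)\<^sup>2) x" for l
    using partial_base_scale[where H="\<lambda>x y. (F x y)\<^sup>2" and a="r\<^sup>2",
        OF F2 assms(1,4) hom \<open>y \<noteq> 0\<close>] .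
  show ?thesis
    unfolding spray_def fund_tensor_scale[OF assms] dxdy dx vec_eq_iff
    by (simp add: sum_distrib_left algebra_simps power2_eq_square)
qed

lemma distortion_scale:
  assumes "open U" "finsler_metric U F" "abs_homogeneous U F" "x \<in> U" "y \<noteq> 0" "r \<noteq> 0"
  shows "distortion F x (r *\<^sub>R y) = distortion F x y"
  by (simp add: distortion_def fund_tensor_scale[OF assms])

lemma geodesic_reparametrize:
  assumes "open U" "finsler_metric U F" "abs_homogeneous U F" "r \<noteq> 0"
    and geo: "geodesic U F {-\<epsilon><..<\<epsilon>} \<sigma> v"
  shows "geodesic U F {-(\<epsilon> / \<bar>r\<bar>)<..<\<epsilon> / \<bar>r\<bar>} (\<lambda>t. \<sigma> (r * t)) (\<lambda>t. r *\<^sub>R v (r * t))"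
  unfolding geodesic_def
proof (intro ballI conjI)
  fix t assume "t \<in> {-(\<epsilon> / \<bar>r\<bar>)<..<\<epsilon> / \<bar>r\<bar>}"
  then have "\<bar>t\<bar> * \<bar>r\<bar> < \<epsilon>"
    using \<open>r \<noteq> 0\<close> by (auto simp: pos_less_divide_eq[symmetric] abs_less_iff)
  then have "\<bar>r * t\<bar> < \<epsilon>"
    by (simp add: abs_mult mult.commute)
  then have rt: "r * t \<in> {-\<epsilon><..<\<epsilon>}"
    by auto
  then show U: "\<sigma> (r * t) \<in> U"
    using geo by (auto simp: geodesic_def)
  from rt have v0: "v (r * t) \<noteq> 0"
    using geo by (auto simp: geodesic_def)
  with \<open>r \<noteq> 0\<close> show "r *\<^sub>R v (r * t) \<noteq> 0"
    by simp
  have lin: "((\<lambda>t. r * t) has_vector_derivative r) (at t)"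
    by (auto intro!: derivative_eq_intros)
  have chain: "((\<lambda>t. g (r * t)) has_vector_derivative r *\<^sub>R g') (at t)"
    if "(g has_vector_derivative g') (at (r * t))" for g and g' :: "real ^ 'n"
    using vector_diff_chain_at[OF lin that] by (simp add: o_def)
  show "((\<lambda>t. \<sigma> (r * t)) has_vector_derivative r *\<^sub>R v (r * t)) (at t)"
    using geo rt by (intro chain) (auto simp: geodesic_def)
  have "((\<lambda>t. v (r * t)) has_vector_derivative r *\<^sub>R (- 2 *\<^sub>R spray F (\<sigma> (r * t)) (v (r * t)))) (at t)"
    using geo rt by (intro chain) (auto simp: geodesic_def)
  from has_vector_derivative_scaleR[OF DERIV_const[of r] this]
  show "((\<lambda>t. r *\<^sub>R v (r * t)) has_vector_derivative
      - 2 *\<^sub>R spray F (\<sigma> (r * t)) (r *\<^sub>R v (r * t))) (at t)"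
    by (simp add: spray_scale[OF assms(1-3) U v0 \<open>r \<noteq> 0\<close>] power2_eq_square mult_ac)
qed

section \<open>The S-curvature\<close>

text \<open>
  The numbers over which the definition of the S-curvature applies its definite description; naming
  the predicate separates the geometry from the choice of a value.
\<close>

definition S_value ::
  "(real ^ 'n::finite) set \<Rightarrow> 'n tfun \<Rightarrow> real ^ 'n \<Rightarrow> real ^ 'n \<Rightarrow> real \<Rightarrow> bool" where
  "S_value U F x y s \<longleftrightarrow>
     (\<exists>\<epsilon>>0. \<exists>\<sigma> v. geodesic U F {-\<epsilon><..<\<epsilon>} \<sigma> v \<and> \<sigma> 0 = x \<and> v 0 = y \<and>
        ((\<lambda>t. distortion F (\<sigma> t) (v t)) has_real_derivative s) (at 0))"

lemma S_curvature_eq_The: "S_curvature U F x y = (THE s. S_value U F x y s)"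
  by (simp add: S_curvature_def S_value_def)

text \<open>
  Geodesics with equal initial data agree near \<open>0\<close>, hence so do the distortions along them.
\<close>

lemma S_value_unique:
  assumes "open U" "finsler_metric U F" "S_value U F x y s" "S_value U F x y s'"
  shows "s = s'"
proof -
  obtain \<epsilon> \<sigma> v where 1: "\<epsilon> > 0" "geodesic U F {-\<epsilon><..<\<epsilon>} \<sigma> v" "\<sigma> 0 = x" "v 0 = y"
    "((\<lambda>t. distortion F (\<sigma> t) (v t)) has_real_derivative s) (at 0)"
    using assms(3) unfolding S_value_def by blast
  obtain \<epsilon>' \<sigma>' v' where 2: "\<epsilon>' > 0" "geodesic U F {-\<epsilon>'<..<\<epsilon>'} \<sigma>' v'" "\<sigma>' 0 = x" "v' 0 = y"
    "((\<lambda>t. distortion F (\<sigma>' t) (v' t)) has_real_derivative s') (at 0)"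
    using assms(4) unfolding S_value_def by blast
  obtain \<delta> where \<delta>: "\<delta> > 0" "\<And>t. \<bar>t\<bar> < \<delta> \<Longrightarrow> \<sigma> t = \<sigma>' t \<and> v t = v' t"
    using geodesic_local_uniqueness[OF assms(1,2) 1(1) 2(1) 1(2) 2(2)] 1(3,4) 2(3,4) by auto
  have "((\<lambda>t. distortion F (\<sigma>' t) (v' t)) has_real_derivative s) (at 0)"
    by (rule has_field_derivative_transform_within_open[OF 1(5), of "{-\<delta><..<\<delta>}"])
      (use \<delta> in auto)
  then show ?thesis
    using 2(5) by (rule DERIV_unique)
qed

text \<open>
  Along the geodesic \<open>t \<mapsto> \<sigma>(r t)\<close> the distortion is that along \<open>\<sigma>\<close> at the time \<open>r t\<close>.
\<close>

lemma S_value_scale: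
  assumes "open U" "finsler_metric U F" "abs_homogeneous U F" "r \<noteq> 0" "S_value U F x y s"
  shows "S_value U F x (r *\<^sub>R y) (r * s)"
proof -
  obtain \<epsilon> \<sigma> v where \<epsilon>: "\<epsilon> > 0" and geo: "geodesic U F {-\<epsilon><..<\<epsilon>} \<sigma> v"
    and init: "\<sigma> 0 = x" "v 0 = y"
    and der: "((\<lambda>t. distortion F (\<sigma> t) (v t)) has_real_derivative s) (at 0)"
    using assms(5) unfolding S_value_def by blast
  have "((\<lambda>t. distortion F (\<sigma> (r * t)) (v (r * t))) has_real_derivative s * r) (at 0)"
    using der by (intro DERIV_chain2[where f="\<lambda>t. distortion F (\<sigma> t) (v t)"])
      (auto intro!: derivative_eq_intros)
  then have "((\<lambda>t. distortion F (\<sigma> (r * t)) (r *\<^sub>R v (r * t))) has_real_derivative s * r) (at 0)"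
  proof (rule has_field_derivative_transform_within_open)
    fix t assume "t \<in> {-(\<epsilon> / \<bar>r\<bar>)<..<\<epsilon> / \<bar>r\<bar>}"
    then have "\<sigma> (r * t) \<in> U" "v (r * t) \<noteq> 0"
      using geodesic_reparametrize[OF assms(1-4) geo] by (auto simp: geodesic_def)
    then show "distortion F (\<sigma> (r * t)) (v (r * t)) = distortion F (\<sigma> (r * t)) (r *\<^sub>R v (r * t))"
      using distortion_scale[OF assms(1-3) _ _ \<open>r \<noteq> 0\<close>] by simp
  qed (use \<epsilon> \<open>r \<noteq> 0\<close> in auto)
  moreover have "\<epsilon> / \<bar>r\<bar> > 0"
    using \<epsilon> \<open>r \<noteq> 0\<close> by simp
  ultimately show ?thesis
    using geodesic_reparametrize[OF assms(1-4) geo] init unfolding S_value_def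
    by (intro exI[of _ "\<epsilon> / \<bar>r\<bar>"] conjI exI[of _ "\<lambda>t. \<sigma> (r * t)"] exI[of _ "\<lambda>t. r *\<^sub>R v (r * t)"])
      (simp_all add: mult.commute)
qed

text \<open>
  The second alternative covers a direction in which no geodesic yields a value. By scaling there is
  then none at any \<open>r y\<close> either, so at all these vectors the description operator is applied to the
  same empty predicate and returns the same number.
\<close>

lemma S_curvature_scale_or_constant:
  assumes "open U" "finsler_metric U F" "abs_homogeneous U F"
  shows "\<exists>u. (\<forall>r. r \<noteq> 0 \<longrightarrow> S_curvature U F x (r *\<^sub>R y) = r * u)
    \<or> (\<forall>r. r \<noteq> 0 \<longrightarrow> S_curvature U F x (r *\<^sub>R y) = u)"
proof (cases "\<exists>s. S_value U F x y s")
  case True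
  then obtain s where s: "S_value U F x y s" by blast
  have "S_curvature U F x (r *\<^sub>R y) = r * s" if "r \<noteq> 0" for r
    unfolding S_curvature_eq_The
    using S_value_scale[OF assms that s] S_value_unique[OF assms(1,2)] by blast
  then show ?thesis by blast
next
  case False
  have "\<not> S_value U F x (r *\<^sub>R y) s" if "r \<noteq> 0" for r s
    using S_value_scale[OF assms, of "inverse r" x "r *\<^sub>R y" s] False that by auto
  then have "S_curvature U F x (r *\<^sub>R y) = (THE s. False)" if "r \<noteq> 0" for r
    using that by (simp add: S_curvature_eq_The)
  then show ?thesis by blast
qed

text \<open>
  On the line through \<open>y\<close> the right-hand side is \<open>\<bar>r\<bar> c F(x, y) + r b\<close>, where \<open>b\<close> is the value of the
  \<open>1\<close>-form at \<open>y\<close>. The values at \<open>r = 1\<close> and \<open>r = -1\<close> show that it can be linear in \<open>r\<close> only if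
  \<open>c F(x, y) = 0\<close>; the values at \<open>1\<close>, \<open>-1\<close> and \<open>2\<close> show the same if it is constant in \<open>r\<close>.
\<close>

lemma S_curvature_isotropic_imp_zero:
  fixes c :: real and \<eta> :: "real ^ 'n"
  assumes "open U" "finsler_metric U F" "abs_homogeneous U F" "x \<in> U" "y \<noteq> 0"
    and S: "\<And>y. y \<noteq> 0 \<Longrightarrow> S_curvature U F x y = c * F x y + (\<Sum>i\<in>UNIV. \<eta> $ i * y $ i)"
  shows "c * F x y = 0"
proof -
  define b where "b = (\<Sum>i\<in>UNIV. \<eta> $ i * y $ i)"
  have S': "S_curvature U F x (r *\<^sub>R y) = \<bar>r\<bar> * (c * F x y) + r * b" if "r \<noteq> 0" for r
  proof -
    have "(\<Sum>i\<in>UNIV. \<eta> $ i * (r *\<^sub>R y) $ i) = r * b"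
      by (simp add: b_def sum_distrib_left algebra_simps)
    moreover have "F x (r *\<^sub>R y) = \<bar>r\<bar> * F x y"
      using assms(3,4) that by (simp add: abs_homogeneous_def)
    ultimately show ?thesis
      using S[of "r *\<^sub>R y"] that \<open>y \<noteq> 0\<close> by (simp add: algebra_simps)
  qed
  from S_curvature_scale_or_constant[OF assms(1-3), of x y]
  obtain u where "(\<forall>r. r \<noteq> 0 \<longrightarrow> \<bar>r\<bar> * (c * F x y) + r * b = r * u)
      \<or> (\<forall>r. r \<noteq> 0 \<longrightarrow> \<bar>r\<bar> * (c * F x y) + r * b = u)"
    using S' by auto
  then show ?thesis
  proof
    assume "\<forall>r. r \<noteq> 0 \<longrightarrow> \<bar>r\<bar> * (c * F x y) + r * b = r * u"
    from this[rule_format, of 1] this[rule_format, of "-1"] show ?thesis by auto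
  next
    assume "\<forall>r. r \<noteq> 0 \<longrightarrow> \<bar>r\<bar> * (c * F x y) + r * b = u"
    from this[rule_format, of 1] this[rule_format, of "-1"] this[rule_format, of 2]
    show ?thesis by auto
  qed
qed

section \<open>The mean Berwald curvature\<close>

text \<open>
  The spray is even in \<open>y\<close>, and each of the three derivatives changes the parity.
\<close>

lemma mean_berwald_uminus:
  assumes "open U" "finsler_metric U F" "abs_homogeneous U F" "x \<in> U" "y \<noteq> 0"
  shows "mean_berwald F x (- y) = - mean_berwald F x y"
proof -
  note G = smooth_tfun_spray[OF assms(1,2)]
  \<comment> \<open>The factors are kept in the form \<open>a / r\<close> with \<open>r = -1\<close> in which the scaling rule returns them.\<close>
  note smooth = smooth_tfun_partial_fibre[OF assms(1)]
  have 0: "spray F x ((-1) *\<^sub>R y) $ i = 1 * spray F x y $ i" if "y \<noteq> 0" for i y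
    using spray_scale[OF assms(1-4) that, of "-1"] by simp
  have 1: "partial l (\<lambda>z. spray F x z $ i) ((-1) *\<^sub>R y) = 1 / (-1) * partial l (\<lambda>z. spray F x z $ i) y"
    if "y \<noteq> 0" for i l y
    using 0 that assms(4) by (intro partial_fibre_scale[OF G]) auto
  have 2: "partial k (partial l (\<lambda>z. spray F x z $ i)) ((-1) *\<^sub>R y)
      = 1 / (-1) / (-1) * partial k (partial l (\<lambda>z. spray F x z $ i)) y" if "y \<noteq> 0" for i k l y
    using 1 that assms(4) by (intro partial_fibre_scale[OF smooth[OF G]]) auto
  have "berwald F x ((-1) *\<^sub>R y) i j k l = 1 / (-1) / (-1) / (-1) * berwald F x y i j k l" for i j k l
    unfolding berwald_def using 2 assms(4,5)
    by (intro partial_fibre_scale[OF smooth[OF smooth[OF G]]]) auto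
  then show ?thesis
    by (simp add: mean_berwald_def vec_eq_iff sum_negf)
qed

lemma angular_metric_uminus:
  assumes "open U" "finsler_metric U F" "abs_homogeneous U F" "x \<in> U" "y \<noteq> 0"
  shows "angular_metric F x (- y) = angular_metric F x y"
proof -
  note F = finsler_metric_smooth[OF assms(2)]
  have 0: "F x ((-1) *\<^sub>R y) = 1 * F x y" for y
    using assms(3,4) by (auto simp: abs_homogeneous_def dest!: bspec spec[of _ "-1::real"])
  have 1: "partial j (F x) ((-1) *\<^sub>R y) = 1 / (-1) * partial j (F x) y" if "y \<noteq> 0" for j y
    using 0 that assms(4) by (intro partial_fibre_scale[OF F]) auto
  have "partial i (partial j (F x)) ((-1) *\<^sub>R y) = 1 / (-1) / (-1) * partial i (partial j (F x)) y" for i j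
    using 1 assms(4,5) by (intro partial_fibre_scale[OF smooth_tfun_partial_fibre[OF assms(1) F]]) auto
  then show ?thesis
    using 0[of y] by (simp add: angular_metric_def vec_eq_iff)
qed

section \<open>Root metrics are absolutely homogeneous\<close>

lemma sym_form_scale: "sym_form m a (r *\<^sub>R y) = r ^ m * sym_form m a y"
proof -
  have "prod_list (map (\<lambda>i. (r *\<^sub>R y) $ i) js) = r ^ length js * prod_list (map (\<lambda>i. y $ i) js)" for js
    by (induction js) auto
  then show ?thesis
    by (auto simp: sym_form_def sum_distrib_left intro!: sum.cong)
qed

text \<open>
  \<open>F\<close> scales by \<open>root m (r\<^sup>m)\<close>, which is \<open>\<bar>r\<bar>\<close> for even \<open>m\<close>. For odd \<open>m\<close> the function \<open>F\<close> is odd and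
  nonnegative, hence zero, and the claim is trivial.
\<close>

lemma mth_root_finsler_metric_abs_homogeneous:
  fixes F :: "real ^ 'n::finite \<Rightarrow> real ^ 'n \<Rightarrow> real"
  assumes "m \<ge> 2" "mth_root_finsler_metric m U F"
  shows "abs_homogeneous U F"
proof -
  obtain a where a: "\<And>x y. x \<in> U \<Longrightarrow> F x y = root m (sym_form m (a x) y)"
    and fin: "finsler_metric U F"
    using assms(2) unfolding mth_root_finsler_metric_def by metis
  have scale: "F x (r *\<^sub>R y) = root m (r ^ m) * F x y" if "x \<in> U" for x y r
    by (simp add: a[OF that] sym_form_scale real_root_mult)
  show ?thesis
  proof (cases "even m")
    case True
    then have "root m (r ^ m) = \<bar>r\<bar>" for r
      using assms(1) by (metis abs_ge_zero power_even_abs real_root_power_cancel zero_less_numeral order_less_le_trans)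
    then show ?thesis
      using scale by (simp add: abs_homogeneous_def)
  next
    case False
    have "F x y = 0" if "x \<in> U" for x y
    proof -
      have "F x (- y) = - F x y"
        using scale[OF that, of "-1" y] False assms(1) by (simp add: odd_real_root_power_cancel real_root_minus)
      moreover have "F x y \<ge> 0" "F x (- y) \<ge> 0"
        using fin that by (auto simp: finsler_metric_def)
      ultimately show ?thesis by simp
    qed
    then show ?thesis
      by (simp add: abs_homogeneous_def)
  qed
qed

theorem theorem1p1:
  fixes U :: "(real ^ 'n::finite) set" and F :: "real ^ 'n \<Rightarrow> real ^ 'n \<Rightarrow> real" and m :: nat
  assumes "open U" and "m \<ge> 2" and "mth_root_finsler_metric m U F"
  shows "(\<forall>\<eta> :: real ^ 'n \<Rightarrow> real ^ 'n.
      (\<exists>c :: real ^ 'n \<Rightarrow> real. \<forall>x\<in>U. \<forall>y. y \<noteq> 0 \<longrightarrow>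
          S_curvature U F x y
            = (real CARD('n) + 1) * c x * F x y + (\<Sum>i\<in>UNIV. \<eta> x $ i * y $ i))
      \<longleftrightarrow>
      (\<forall>x\<in>U. \<forall>y. y \<noteq> 0 \<longrightarrow>
          S_curvature U F x y = (\<Sum>i\<in>UNIV. \<eta> x $ i * y $ i)))
    \<and>
     ((\<exists>c :: real ^ 'n \<Rightarrow> real. \<forall>x\<in>U. \<forall>y. y \<noteq> 0 \<longrightarrow>
          mean_berwald F x y
            = ((real CARD('n) + 1) / 2 * c x * inverse (F x y)) *\<^sub>R angular_metric F x y)
      \<longleftrightarrow>
      (\<forall>x\<in>U. \<forall>y. y \<noteq> 0 \<longrightarrow> mean_berwald F x y = 0))"
proof -
  have fin: "finsler_metric U F"
    using assms(3) by (simp add: mth_root_finsler_metric_def)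
  have hom: "abs_homogeneous U F"
    by (rule mth_root_finsler_metric_abs_homogeneous[OF assms(2,3)])
  show ?thesis
  proof (intro conjI allI iffI)
    fix \<eta> :: "real ^ 'n \<Rightarrow> real ^ 'n"
    assume "\<exists>c. \<forall>x\<in>U. \<forall>y. y \<noteq> 0 \<longrightarrow> S_curvature U F x y
        = (real CARD('n) + 1) * c x * F x y + (\<Sum>i\<in>UNIV. \<eta> x $ i * y $ i)"
    then obtain c where c: "\<And>x y. x \<in> U \<Longrightarrow> y \<noteq> 0 \<Longrightarrow> S_curvature U F x y
        = (real CARD('n) + 1) * c x * F x y + (\<Sum>i\<in>UNIV. \<eta> x $ i * y $ i)"
      by blast
    then show "\<forall>x\<in>U. \<forall>y. y \<noteq> 0 \<longrightarrow> S_curvature U F x y = (\<Sum>i\<in>UNIV. \<eta> x $ i * y $ i)"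
      using S_curvature_isotropic_imp_zero[OF assms(1) fin hom _ _ c] by simp
  next
    fix \<eta> :: "real ^ 'n \<Rightarrow> real ^ 'n"
    assume "\<forall>x\<in>U. \<forall>y. y \<noteq> 0 \<longrightarrow> S_curvature U F x y = (\<Sum>i\<in>UNIV. \<eta> x $ i * y $ i)"
    then show "\<exists>c. \<forall>x\<in>U. \<forall>y. y \<noteq> 0 \<longrightarrow> S_curvature U F x y
        = (real CARD('n) + 1) * c x * F x y + (\<Sum>i\<in>UNIV. \<eta> x $ i * y $ i)"
      by (intro exI[of _ "\<lambda>_. 0"]) simp
  next
    assume "\<exists>c. \<forall>x\<in>U. \<forall>y. y \<noteq> 0 \<longrightarrow> mean_berwald F x y
        = ((real CARD('n) + 1) / 2 * c x * inverse (F x y)) *\<^sub>R angular_metric F x y"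
    then obtain c where c: "\<And>x y. x \<in> U \<Longrightarrow> y \<noteq> 0 \<Longrightarrow> mean_berwald F x y
        = ((real CARD('n) + 1) / 2 * c x * inverse (F x y)) *\<^sub>R angular_metric F x y"
      by blast
    show "\<forall>x\<in>U. \<forall>y. y \<noteq> 0 \<longrightarrow> mean_berwald F x y = 0"
    proof (intro ballI allI impI)
      fix x y :: "real ^ 'n" assume x: "x \<in> U" and y: "y \<noteq> 0"
      have "F x (- y) = F x y"
        using hom x unfolding abs_homogeneous_def
        by (metis abs_neg_one mult_1 neg_equal_0_iff_equal scaleR_minus1_left zero_neq_one)
      then have "mean_berwald F x (- y) = mean_berwald F x y"
        using c[OF x y] c[OF x, of "- y"] y angular_metric_uminus[OF assms(1) fin hom x y] by simp
      then have "2 *\<^sub>R mean_berwald F x y = 0"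
        using mean_berwald_uminus[OF assms(1) fin hom x y] by (simp add: scaleR_2)
      then show "mean_berwald F x y = 0" by simp
    qed
  next
    assume "\<forall>x\<in>U. \<forall>y. y \<noteq> 0 \<longrightarrow> mean_berwald F x y = 0"
    then show "\<exists>c. \<forall>x\<in>U. \<forall>y. y \<noteq> 0 \<longrightarrow> mean_berwald F x y
        = ((real CARD('n) + 1) / 2 * c x * inverse (F x y)) *\<^sub>R angular_metric F x y"
      by (intro exI[of _ "\<lambda>_. 0"]) simp
  qed
qed

end
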